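(* Let $\omega\in[2,3]$. For every even $k\ge4$, $c_k\le \dfrac{k\omega-\frac4k}{2\omega+k-2-\frac4k}$, and this bound holds with equality when $\omega=2$.
   Context: Indices are taken modulo $k$ (points on a circle); for indices $i\ne j$, "$i<r<j$" means $r$ ranges over $i+1,\dots,j-1$ mod $k$. Let $M(a,b,c)=a+b+c-(3-\omega)\min\{a,b,c\}$. For $d=(d_0,\dots,d_{k-1})\in[0,1]^k$ define $P^d_{i,j}$ for $i\ne j$ by $P^d_{i,i+1}=1$ and, for $j\ne i+1$, $P^d_{i,j}=\min\{P^d_{i,j-1}+d_{j-1},\ P^d_{i+1,j}+d_{i+1},\ \min_{i<r<j}\max\{P^d_{i,r},P^d_{r,j},M(1-d_i,1-d_r,1-d_j)\}\}$. Let $C_k(d)=\min_{0\le i<j\le k-1}\max\{P^d_{i,j},P^d_{j,i}\}$ and $c_k=\sup_{d\in[0,1]^k}\min\{\min_i(2-d_i),\ C_k(d)\}$ (the running-time exponent, in terms of the number of edges $m$, of the Yuster–Zwick directed $k$-cycle detection algorithm). *)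

theory Defs
  imports Complex_Main "HOL-Library.FuncSet"
begin

text \<open>The points of the circle are the naturals \<open>0, \<dots>, k - 1\<close>;
  \<open>cdist k i j\<close> is the number of steps from \<open>i\<close> forward to \<open>j\<close>.\<close>

definition cdist :: "nat \<Rightarrow> nat \<Rightarrow> nat \<Rightarrow> nat" where
  "cdist k i j = (j + k - i) mod k"

text \<open>The points \<open>i + 1, \<dots>, j - 1\<close> modulo \<open>k\<close>, strictly between \<open>i\<close> and \<open>j\<close>
  when moving forward from \<open>i\<close>.\<close>

definition between :: "nat \<Rightarrow> nat \<Rightarrow> nat \<Rightarrow> nat set" where
  "between k i j = {r. r < k \<and> 0 < cdist k i r \<and> cdist k i r < cdist k i j}"

definition mmexp :: "real \<Rightarrow> real \<Rightarrow> real \<Rightarrow> real \<Rightarrow> real" where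
  "mmexp \<omega> a b c = a + b + c - (3 - \<omega>) * min a (min b c)"

lemma cdist_step:
  assumes "i < k" "j < k" "i \<noteq> j" "j \<noteq> (i + 1) mod k"
  shows "cdist k i ((j + k - 1) mod k) < cdist k i j"
    and "cdist k ((i + 1) mod k) j < cdist k i j"
proof -
  have c: "cdist k x y = (if x \<le> y then y - x else y + k - x)" if "x < k" "y < k" for x y
    using that by (auto simp: cdist_def mod_if)
  have p: "(j + k - 1) mod k = (if j = 0 then k - 1 else j - 1)"
    using assms by (auto simp: mod_if)
  have s: "(i + 1) mod k = (if i + 1 = k then 0 else i + 1)"
    using assms by (auto simp: mod_if)
  show "cdist k i ((j + k - 1) mod k) < cdist k i j"
    using assms c[of i j] c[of i "(j + k - 1) mod k"] unfolding p s
    by (auto split: if_splits)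
  show "cdist k ((i + 1) mod k) j < cdist k i j"
    using assms c[of i j] c[of "(i + 1) mod k" j] unfolding s
    by (auto split: if_splits)
qed

lemma cdist_between:
  assumes "i < k" "j < k" "r \<in> between k i j"
  shows "cdist k i r < cdist k i j" and "cdist k r j < cdist k i j"
proof -
  have c: "cdist k x y = (if x \<le> y then y - x else y + k - x)" if "x < k" "y < k" for x y
    using that by (auto simp: cdist_def mod_if)
  show "cdist k i r < cdist k i j"
    using assms by (simp add: between_def)
  show "cdist k r j < cdist k i j"
    using assms c[of i j] c[of i r] c[of r j]
    by (auto simp: between_def split: if_splits)
qed

text \<open>The value \<open>0\<close> outside \<open>i, j < k\<close>, \<open>i \<noteq> j\<close> is junk; the recursion never reaches it from
  arguments with \<open>i, j < k\<close>, \<open>i \<noteq> j\<close>.\<close>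

function P :: "real \<Rightarrow> nat \<Rightarrow> (nat \<Rightarrow> real) \<Rightarrow> nat \<Rightarrow> nat \<Rightarrow> real" where
  "P \<omega> k d i j =
     (if i < k \<and> j < k \<and> i \<noteq> j then
        if j = (i + 1) mod k then 1
        else min (P \<omega> k d i ((j + k - 1) mod k) + d ((j + k - 1) mod k))
            (min (P \<omega> k d ((i + 1) mod k) j + d ((i + 1) mod k))
                 (MIN r\<in>between k i j.
                    max (P \<omega> k d i r)
                        (max (P \<omega> k d r j) (mmexp \<omega> (1 - d i) (1 - d r) (1 - d j)))))
      else 0)"
  by pat_completeness auto
termination
  by (relation "measure (\<lambda>(\<omega>, k, d, i, j). cdist k i j)")
    (use cdist_step cdist_between in auto)

declare P.simps [simp del]

definition C :: "real \<Rightarrow> nat \<Rightarrow> (nat \<Rightarrow> real) \<Rightarrow> real" where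
  "C \<omega> k d = Min {max (P \<omega> k d i j) (P \<omega> k d j i) | i j. i < j \<and> j \<le> k - 1}"

definition c :: "real \<Rightarrow> nat \<Rightarrow> real" where
  "c \<omega> k = (SUP d\<in>{..<k} \<rightarrow>\<^sub>E {0..1}. min (MIN i\<in>{..<k}. 2 - d i) (C \<omega> k d))"

text \<open>The supremum is taken over a nonempty set of reals that is bounded above.\<close>

lemma c_bdd_above:
  assumes "0 < k"
  shows "bdd_above ((\<lambda>d. min (MIN i\<in>{..<k}. 2 - d i) (C \<omega> k d)) ` ({..<k} \<rightarrow>\<^sub>E {0..1}))"
proof (rule bdd_aboveI2)
  fix d :: "nat \<Rightarrow> real"
  assume "d \<in> {..<k} \<rightarrow>\<^sub>E {0..1}"
  then have "0 \<le> d 0"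
    using assms by (force simp: PiE_iff)
  moreover have "(MIN i\<in>{..<k}. 2 - d i) \<le> 2 - d 0"
    using assms by (intro Min_le) auto
  ultimately show "min (MIN i\<in>{..<k}. 2 - d i) (C \<omega> k d) \<le> 2"
    by linarith
qed

end

(* Upper bound, k = 2h: call an arc good if its P-value is at most the claimed exponent, and suppose
that no two complementary arcs are good. Let delta be the constant weight at which a matrix
multiplication step costs exactly that exponent. Arcs with few or light interior points are good, and good
arcs combine at a middle point whose weight is at least delta minus (omega - 1) t if both outer
weights are at least delta + t. Cut the circle at a shortest bad arc between points of weight at least
delta. For a level t, the outermost points of weight at least delta + t enclose an arc through the cut;
a point of it that can be reached cheaply from both ends must have weight below
delta - (omega - 1) t, or else everything combines. Raise t until fewer than 2h points are
reachable (counted from both ends). Up to that level the deficits below delta dominate the excesses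
above it, by comparing level sets, and this contradicts the weight that the reachable parts must have.

Lower bound, omega = 2: for an explicit weight vector, P i j is at least 1 plus the interior weight of
the arc (capped), because combination steps are too expensive; and one of any two complementary
arcs is heavy. *)

theory Submission
  imports Defs
begin

section \<open>Arcs with integer endpoints\<close>

text \<open>Integer positions unroll the circle: an arc is \<open>i < j < i + k\<close> without
  wraparound, and its complement runs from \<open>j\<close> to \<open>i + k\<close>.\<close>

definition idx :: "nat \<Rightarrow> int \<Rightarrow> nat" where
  "idx k i = nat (i mod int k)"

lemma idx_less: "0 < k \<Longrightarrow> idx k i < k"
  unfolding idx_def by (simp add: nat_less_iff)

lemma int_idx: "0 < k \<Longrightarrow> int (idx k i) = i mod int k"
  unfolding idx_def by simp

lemma idx_of_nat: "i < k \<Longrightarrow> idx k (int i) = i"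
  unfolding idx_def by simp

lemma idx_add_period: "idx k (i + int k) = idx k i"
  unfolding idx_def by simp

lemma idx_eq_iff:
  assumes "0 < k" "\<bar>i - j\<bar> < int k"
  shows "idx k i = idx k j \<longleftrightarrow> i = j"
proof
  assume "idx k i = idx k j"
  then have "i mod int k = j mod int k"
    by (metis assms(1) int_idx)
  then have "int k dvd i - j"
    by (simp add: mod_eq_dvd_iff)
  then show "i = j"
    using assms(2) dvd_imp_le_int[of "i - j" "int k"] by fastforce
qed simp

lemma idx_succ: "0 < k \<Longrightarrow> idx k (i + 1) = (idx k i + 1) mod k"
  by (rule injD[OF inj_of_nat[where 'a = int]])
    (simp add: int_idx zmod_int mod_simps add.commute)

lemma idx_pred: "0 < k \<Longrightarrow> idx k (i - 1) = (idx k i + k - 1) mod k"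
  by (rule injD[OF inj_of_nat[where 'a = int]])
    (simp add: int_idx zmod_int of_nat_diff, metis add_diff_eq diff_add_eq mod_add_self2 mod_diff_left_eq)

lemma cdist_idx:
  assumes "0 < k" "i \<le> j" "j < i + int k"
  shows "int (cdist k (idx k i) (idx k j)) = j - i"
proof -
  have "int (cdist k (idx k i) (idx k j)) = (j mod int k + int k - i mod int k) mod int k"
    using idx_less[OF assms(1), of i] assms(1)
    by (simp add: cdist_def zmod_int of_nat_diff int_idx)
  also have "\<dots> = (j - i) mod int k"
    by (metis add_diff_eq diff_add_eq mod_add_self2 mod_diff_eq)
  finally show ?thesis
    using assms by simp
qed

lemma between_idx:
  assumes "i < j" "j < i + int k"
  shows "between k (idx k i) (idx k j) = idx k ` {i<..<j}"
proof -
  have k: "0 < k"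
    using assms by simp
  have mem: "idx k r \<in> between k (idx k i) (idx k j) \<longleftrightarrow> r \<in> {i<..<j}"
    if "i \<le> r" "r < i + int k" for r
    using cdist_idx[OF k that] cdist_idx[OF k _ assms(2)] assms(1) idx_less[OF k, of r]
    by (auto simp: between_def)
  show ?thesis
  proof (intro equalityI subsetI)
    fix s assume s: "s \<in> between k (idx k i) (idx k j)"
    define r where "r = i + (int s - i) mod int k"
    have r: "i \<le> r" "r < i + int k"
      using k by (auto simp: r_def)
    have "s < k"
      using s by (simp add: between_def)
    then have "idx k r = s"
      by (simp add: idx_def r_def mod_simps)
    then show "s \<in> idx k ` {i<..<j}"
      using mem[OF r] s by auto
  qed (use mem assms in auto)
qed

definition arcP :: "real \<Rightarrow> nat \<Rightarrow> (nat \<Rightarrow> real) \<Rightarrow> int \<Rightarrow> int \<Rightarrow> real" where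
  "arcP \<omega> k d i j = P \<omega> k d (idx k i) (idx k j)"

lemma arcP_rec:
  assumes "i < j" "j < i + int k"
  shows "arcP \<omega> k d i j =
    (if j = i + 1 then 1
     else min (arcP \<omega> k d i (j - 1) + d (idx k (j - 1)))
         (min (arcP \<omega> k d (i + 1) j + d (idx k (i + 1)))
              (MIN r\<in>{i<..<j}. max (arcP \<omega> k d i r) (max (arcP \<omega> k d r j)
                 (mmexp \<omega> (1 - d (idx k i)) (1 - d (idx k r)) (1 - d (idx k j)))))))"
proof -
  have k: "0 < k"
    using assms by simp
  have ne: "idx k i \<noteq> idx k j"
    using assms k by (subst idx_eq_iff) auto
  have succ: "idx k j = idx k (i + 1) \<longleftrightarrow> j = i + 1"
    using assms k by (subst idx_eq_iff) auto
  show ?thesis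
    unfolding arcP_def
    by (subst P.simps)
      (simp only: ne succ idx_less[OF k] between_idx[OF assms] image_image
        idx_pred[OF k, symmetric] idx_succ[OF k, symmetric] simp_thms if_True not_False_eq_True)
qed

lemma arcP_combine:
  assumes "i < r" "r < j" "j < i + int k"
  shows "arcP \<omega> k d i j \<le> max (arcP \<omega> k d i r) (max (arcP \<omega> k d r j)
           (mmexp \<omega> (1 - d (idx k i)) (1 - d (idx k r)) (1 - d (idx k j))))"
proof -
  have "(MIN r\<in>{i<..<j}. max (arcP \<omega> k d i r) (max (arcP \<omega> k d r j)
           (mmexp \<omega> (1 - d (idx k i)) (1 - d (idx k r)) (1 - d (idx k j)))))
        \<le> max (arcP \<omega> k d i r) (max (arcP \<omega> k d r j)
           (mmexp \<omega> (1 - d (idx k i)) (1 - d (idx k r)) (1 - d (idx k j))))"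
    using assms by (intro Min_le) auto
  moreover have "j \<noteq> i + 1"
    using assms by simp
  ultimately show ?thesis
    using assms by (simp only: arcP_rec[of i j] if_False min_le_iff_disj) simp
qed

lemma arcP_le_sum:
  assumes "i < j" "j < i + int k"
  shows "arcP \<omega> k d i j \<le> 1 + (\<Sum>r\<in>{i<..<j}. d (idx k r))"
  using assms
proof (induction j rule: int_gr_induct)
  case base
  moreover have "{i<..<i + 1} = {}"
    by auto
  ultimately show ?case
    by (simp only: arcP_rec[of i "i + 1"]) simp
next
  case (step j)
  have "{i<..<j + 1} = insert j {i<..<j}"
    using step by auto
  then have "(\<Sum>r\<in>{i<..<j + 1}. d (idx k r)) = d (idx k j) + (\<Sum>r\<in>{i<..<j}. d (idx k r))"
    by simp
  moreover have "arcP \<omega> k d i (j + 1) \<le> arcP \<omega> k d i j + d (idx k j)"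
    using step.hyps step.prems by (simp only: arcP_rec[of i "j + 1"] min_le_iff_disj) simp
  ultimately show ?case
    using step.IH step.prems by linarith
qed

text \<open>Discrete layer-cake argument: a largest \<open>v a\<close> is matched with some
  \<open>u b\<close> at least as large. Deleting both keeps the counts comparable: levels up to
  \<open>v a\<close> lose one point on each side, higher ones are empty on the left.\<close>

lemma sum_le_sum_if_level_card_le:
  fixes v :: "'a \<Rightarrow> real" and u :: "'b \<Rightarrow> real"
  assumes "finite I" "finite J"
    and "\<And>i. i \<in> I \<Longrightarrow> 0 \<le> v i" "\<And>j. j \<in> J \<Longrightarrow> 0 \<le> u j"
    and "\<And>s. 0 < s \<Longrightarrow> card {i \<in> I. s \<le> v i} \<le> card {j \<in> J. s \<le> u j}"
  shows "sum v I \<le> sum u J"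
  using assms
proof (induction "card I" arbitrary: I J)
  case 0
  then show ?case
    by (simp add: sum_nonneg)
next
  case (Suc n)
  then have "I \<noteq> {}"
    by auto
  then obtain a where a: "a \<in> I" and a_max: "\<And>i. i \<in> I \<Longrightarrow> v i \<le> v a"
    using Suc.prems(1) Max_in[of "v ` I"] Max_ge[of "v ` I"] by fastforce
  show ?case
  proof (cases "v a \<le> 0")
    case True
    then have "sum v I \<le> 0"
      using a_max by (meson order_trans sum_nonpos)
    then show ?thesis
      using Suc.prems(4) by (meson order_trans sum_nonneg)
  next
    case False
    have "a \<in> {i \<in> I. v a \<le> v i}"
      using a by simp
    then have "card {i \<in> I. v a \<le> v i} \<noteq> 0"
      using Suc.prems(1) by (subst card_0_eq) auto
    then have "card {j \<in> J. v a \<le> u j} \<noteq> 0"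
      using Suc.prems(5)[of "v a"] False by linarith
    then obtain b where b: "b \<in> J" "v a \<le> u b"
      by (metis (no_types, lifting) card.empty empty_Collect_eq)
    have "sum v (I - {a}) \<le> sum u (J - {b})"
    proof (rule Suc.hyps(1))
      fix s :: real assume s: "0 < s"
      show "card {i \<in> I - {a}. s \<le> v i} \<le> card {j \<in> J - {b}. s \<le> u j}"
      proof (cases "s \<le> v a")
        case True
        have "{i \<in> I - {a}. s \<le> v i} = {i \<in> I. s \<le> v i} - {a}"
          "{j \<in> J - {b}. s \<le> u j} = {j \<in> J. s \<le> u j} - {b}"
          by auto
        then show ?thesis
          using Suc.prems(5)[OF s] a b True by simp
      next
        case False
        then have "{i \<in> I - {a}. s \<le> v i} = {}"
          using a_max by fastforce
        then show ?thesis
          by (simp only: card.empty)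
      qed
    qed (use Suc a in auto)
    then show ?thesis
      using b sum.remove[OF Suc.prems(1) a, of v] sum.remove[OF Suc.prems(2) b(1), of u] by linarith
  qed
qed

section \<open>Systems of good arcs\<close>

text \<open>Here \<open>1 + (h - 1) * (\<delta> + \<epsilon>)\<close> and \<open>\<omega> * (1 - \<delta>)\<close> are both the claimed exponent: \<open>\<delta>\<close> is the
  constant weight at which a matrix multiplication step costs exactly that much, and
  \<open>\<epsilon>\<close> is the excess over \<open>\<delta>\<close> that \<open>h - 1\<close> consecutive weights can afford on average.\<close>

locale good_arcs =
  fixes h :: nat and \<omega> \<delta> \<epsilon> :: real and D :: "int \<Rightarrow> real" and G :: "int \<Rightarrow> int \<Rightarrow> bool"
  assumes h_ge_2: "2 \<le> h" and omega: "2 \<le> \<omega>" "\<omega> \<le> 3"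
    and eps_pos: "0 < \<epsilon>" and delta_eq: "\<delta> = (real h * \<omega> - 1) * \<epsilon>"
    and D_nonneg: "0 \<le> D i"
    and D_period: "D (i + 2 * int h) = D i"
    and G_sum: "i < j \<Longrightarrow> j < i + 2 * int h \<Longrightarrow> (\<Sum>r\<in>{i<..<j}. D r) \<le> (real h - 1) * (\<delta> + \<epsilon>) \<Longrightarrow> G i j"
    and G_combine: "i < r \<Longrightarrow> r < j \<Longrightarrow> j < i + 2 * int h \<Longrightarrow> G i r \<Longrightarrow> G r j \<Longrightarrow>
      0 \<le> t \<Longrightarrow> t \<le> D i - \<delta> \<Longrightarrow> t \<le> D j - \<delta> \<Longrightarrow> - ((\<omega> - 1) * t) \<le> D r - \<delta> \<Longrightarrow> G i j"
    and G_not_both: "i < j \<Longrightarrow> j < i + 2 * int h \<Longrightarrow> G i j \<Longrightarrow> \<not> G j (i + 2 * int h)"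
begin

section \<open>Excess over \<delta> and a shortest bad arc\<close>

definition y :: "int \<Rightarrow> real" where "y i = D i - \<delta>"

definition x :: real where "x = (real h - 1) * (\<delta> + \<epsilon>)"

definition S :: "int \<Rightarrow> int \<Rightarrow> real" where "S i j = sum D {i<..<j}"

lemma y_period: "y (i + 2 * int h) = y i" "y (i - 2 * int h) = y i"
  using D_period[of i] D_period[of "i - 2 * int h"] by (simp_all add: y_def)

lemma delta_pos: "0 < \<delta>"
proof -
  have "2 * 2 \<le> real h * \<omega>"
    using h_ge_2 omega by (intro mult_mono) auto
  then show ?thesis
    using eps_pos by (simp add: delta_eq)
qed

lemma S_mono: "i' \<le> i \<Longrightarrow> j \<le> j' \<Longrightarrow> S i j \<le> S i' j'"
  unfolding S_def by (intro sum_mono2) (auto simp: D_nonneg)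

lemma G_if_S_le: "i < j \<Longrightarrow> j < i + 2 * int h \<Longrightarrow> S i j \<le> x \<Longrightarrow> G i j"
  using G_sum by (simp add: S_def x_def)

lemma G_if_low:
  assumes "i < j" "j \<le> i + int h" "\<And>r. r \<in> {i<..<j} \<Longrightarrow> y r < 0"
  shows "G i j"
proof (rule G_if_S_le)
  have "S i j \<le> real (card {i<..<j}) * \<delta>"
    unfolding S_def using assms(3) by (intro sum_bounded_above) (force simp: y_def)
  also have "\<dots> \<le> (real h - 1) * \<delta>"
    using assms delta_pos by (intro mult_right_mono) auto
  also have "\<dots> \<le> x"
    unfolding x_def using h_ge_2 eps_pos by (intro mult_left_mono) auto
  finally show "S i j \<le> x" .
qed (use assms h_ge_2 in auto)

text \<open>Otherwise cutting at the only high point (or anywhere) and at its antipode gives two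
  complementary arcs with \<open>h - 1\<close> low interior points each, both good.\<close>

lemma two_high:
  obtains i j where "i < j" "j < i + 2 * int h" "0 \<le> y i" "0 \<le> y j"
proof (rule ccontr)
  assume "\<not> thesis"
  then have none: "\<not> (i < j \<and> j < i + 2 * int h \<and> 0 \<le> y i \<and> 0 \<le> y j)" for i j
    using that by blast
  obtain a where a: "\<And>r. r \<in> {a<..<a + 2 * int h} \<Longrightarrow> y r < 0"
  proof (cases "\<exists>a. 0 \<le> y a")
    case True
    then show ?thesis
      using none that by (metis greaterThanLessThan_iff not_le)
  next
    case False
    then show ?thesis
      using that[of 0] by (meson not_le)
  qed
  have "G a (a + int h)" "G (a + int h) (a + 2 * int h)"
    using h_ge_2 by (auto intro!: G_if_low a)
  then show False
    using G_not_both[of a "a + int h"] h_ge_2 by auto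
qed

lemma shortest_bad:
  obtains i j where "i < j" "j < i + 2 * int h" "0 \<le> y i" "0 \<le> y j" "\<not> G i j"
    "\<And>i' j'. i' < j' \<Longrightarrow> j' - i' < j - i \<Longrightarrow> 0 \<le> y i' \<Longrightarrow> 0 \<le> y j' \<Longrightarrow> G i' j'"
proof -
  define bad where "bad = (\<lambda>(i, j). i < j \<and> j < i + 2 * int h \<and> 0 \<le> y i \<and> 0 \<le> y j \<and> \<not> G i j)"
  obtain i j where ij: "i < j" "j < i + 2 * int h" "0 \<le> y i" "0 \<le> y j"
    by (rule two_high)
  then have "bad (i, j) \<or> bad (j, i + 2 * int h)"
    using G_not_both[OF ij(1,2)] by (auto simp: bad_def y_period)
  then obtain e where "bad e"
    by blast
  from ex_has_least_nat[of bad, OF this, where m = "\<lambda>(i, j). nat (j - i)"]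
  obtain i j where bad: "bad (i, j)"
    and least: "\<And>i' j'. bad (i', j') \<Longrightarrow> nat (j - i) \<le> nat (j' - i')"
    by auto
  show ?thesis
  proof (rule that)
    fix i' j' assume *: "i' < j'" "j' - i' < j - i" "0 \<le> y i'" "0 \<le> y j'"
    then show "G i' j'"
      using least[of i' j'] bad by (force simp: bad_def)
  qed (use bad in \<open>auto simp: bad_def\<close>)
qed

end

text \<open>The circle is cut at a shortest bad arc, from \<open>b\<close> forward to \<open>a + 2 * h\<close>, between points of
  weight at least \<open>\<delta>\<close>.\<close>

locale good_arcs_cut = good_arcs +
  fixes a b :: int
  assumes ab: "a < b" "b < a + 2 * int h" and high_ends: "0 \<le> y a" "0 \<le> y b"
    and bad: "\<not> G b (a + 2 * int h)"
    and shorter: "i < j \<Longrightarrow> j - i < a + 2 * int h - b \<Longrightarrow> 0 \<le> y i \<Longrightarrow> 0 \<le> y j \<Longrightarrow> G i j"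
begin

text \<open>A high point inside would split the bad arc into two shorter, hence good, arcs, which
  combine there at level \<open>t = 0\<close>.\<close>

lemma low_outside: "b < i \<Longrightarrow> i < a + 2 * int h \<Longrightarrow> y i < 0"
  using G_combine[of b i "a + 2 * int h" 0] shorter[of b i] shorter[of i "a + 2 * int h"]
    bad ab high_ends by (force simp: y_period y_def D_period)

text \<open>The interior of the bad arc is low, so a length of at most \<open>h\<close> would make
  the arc good.\<close>

lemma block_short: "b - a < int h"
  using G_if_low[of b "a + 2 * int h"] low_outside bad ab by force

lemma G_inside: "a \<le> p \<Longrightarrow> p < q \<Longrightarrow> q \<le> b \<Longrightarrow> 0 \<le> y p \<Longrightarrow> 0 \<le> y q \<Longrightarrow> G p q"
  using block_short by (intro shorter) auto

section \<open>Frames and the points reachable from their ends\<close>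

definition gap :: "int \<Rightarrow> int \<Rightarrow> int set" where
  "gap p q = {q<..<p + 2 * int h}"

text \<open>The arc from \<open>q\<close> to such a point is good by weight alone;
  \<open>suf\<close> is the mirror image.\<close>

definition pre :: "int \<Rightarrow> int \<Rightarrow> int set" where
  "pre p q = {i \<in> gap p q. S q i \<le> x}"

definition suf :: "int \<Rightarrow> int \<Rightarrow> int set" where
  "suf p q = {i \<in> gap p q. S i (p + 2 * int h) \<le> x}"

definition frame :: "int \<Rightarrow> int \<Rightarrow> bool" where
  "frame p q \<longleftrightarrow> a \<le> p \<and> p \<le> q \<and> q \<le> b \<and> 0 \<le> y p \<and> 0 \<le> y q \<and>
     (\<forall>i\<in>gap p q. y i \<le> min (y p) (y q))"

lemma finite_gap [simp]: "finite (gap p q)"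
  by (simp add: gap_def)

lemma finite_pre_suf [simp]: "finite (pre p q)" "finite (suf p q)"
  by (simp_all add: pre_def suf_def)

lemma card_gap: "q \<le> b \<Longrightarrow> a \<le> p \<Longrightarrow> int (card (gap p q)) = 2 * int h - 1 - (q - p)"
  using ab by (simp add: gap_def)

text \<open>At a heavier \<open>i\<close> the two good arcs would combine at level
  \<open>min (y p) (y q)\<close>, so that the gap arc and its complement from \<open>p\<close> to
  \<open>q\<close> are both good. If \<open>p = q\<close>, the two arcs at \<open>i\<close> are
  themselves complementary.\<close>

lemma core_low:
  assumes "frame p q" "i \<in> pre p q" "i \<in> suf p q"
  shows "y i < - ((\<omega> - 1) * min (y p) (y q))" "p < q"
proof -
  have i: "q < i" "i < p + 2 * int h" "a \<le> p" "p \<le> q" "q \<le> b" "0 \<le> y p" "0 \<le> y q"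
    using assms by (auto simp: frame_def pre_def gap_def)
  have G: "G q i" "G i (p + 2 * int h)"
    using assms i by (auto simp: pre_def suf_def intro!: G_if_S_le)
  show "p < q"
  proof (rule ccontr)
    assume "\<not> p < q"
    then have "p = q"
      using i by simp
    then show False
      using G_not_both[of p i] G i by simp
  qed
  then have "G p q"
    using i by (intro G_inside)
  then have not_G: "\<not> G q (p + 2 * int h)"
    using G_not_both[of p q] i \<open>p < q\<close> by auto
  show "y i < - ((\<omega> - 1) * min (y p) (y q))"
  proof (rule ccontr)
    assume "\<not> y i < - ((\<omega> - 1) * min (y p) (y q))"
    then show False
      using G_combine[of q i "p + 2 * int h" "min (y p) (y q)"] not_G G i \<open>p < q\<close>
      by (simp add: y_def D_period)
  qed
qed

text \<open>Otherwise \<open>q + 1\<close> is reachable from both ends, so \<open>p < q\<close> by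
  \<open>core_low\<close>, and two complementary arcs are good.\<close>

lemma S_gap:
  assumes "frame p q"
  shows "x < S q (p + 2 * int h)"
proof (rule ccontr)
  assume "\<not> x < S q (p + 2 * int h)"
  then have le: "S q (p + 2 * int h) \<le> x"
    by simp
  have pq: "a \<le> p" "p \<le> q" "q \<le> b"
    using assms by (auto simp: frame_def)
  then have in_gap: "q + 1 \<in> gap p q"
    using block_short by (auto simp: gap_def)
  have "S q (q + 1) \<le> x"
    using S_mono[of q q "q + 1" "p + 2 * int h"] le in_gap by (simp add: gap_def)
  moreover have "S (q + 1) (p + 2 * int h) \<le> x"
    using S_mono[of q "q + 1" "p + 2 * int h" "p + 2 * int h"] le by simp
  ultimately have core: "q + 1 \<in> pre p q" "q + 1 \<in> suf p q"
    using in_gap by (auto simp: pre_def suf_def)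
  have "p < q"
    using core_low(2)[OF assms core] .
  moreover have "G q (p + 2 * int h)"
    using le pq \<open>p < q\<close> ab by (intro G_if_S_le) auto
  moreover have "G p q"
    using assms \<open>p < q\<close> by (intro G_inside) (auto simp: frame_def)
  ultimately show False
    using G_not_both[of p q] pq ab by auto
qed

text \<open>By \<open>S_gap\<close> some gap point is not in \<open>pre p q\<close>; the weight
  before the first such \<open>m\<close> exceeds \<open>x\<close> and lies entirely in
  \<open>pre p q\<close>.\<close>

lemma S_pre:
  assumes "frame p q"
  shows "x < sum D (pre p q)"
proof (rule ccontr)
  assume "\<not> x < sum D (pre p q)"
  then have le: "sum D (pre p q) \<le> x"
    by simp
  have "gap p q - pre p q \<noteq> {}"
  proof
    assume "gap p q - pre p q = {}"
    then have "pre p q = gap p q"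
      by (auto simp: pre_def)
    then show False
      using S_gap[OF assms] le by (simp add: S_def gap_def)
  qed
  then have "Min (gap p q - pre p q) \<in> gap p q - pre p q"
    by (intro Min_in) auto
  moreover define m where "m = Min (gap p q - pre p q)"
  ultimately have m: "m \<in> gap p q" "m \<notin> pre p q"
    by auto
  have "i \<in> pre p q" if "i \<in> {q<..<m}" for i
  proof (rule ccontr)
    assume "i \<notin> pre p q"
    then have "m \<le> i"
      unfolding m_def using that m by (intro Min_le) (auto simp: gap_def)
    then show False
      using that by simp
  qed
  then have "S q m \<le> sum D (pre p q)"
    unfolding S_def by (intro sum_mono2) (auto simp: D_nonneg)
  then show False
    using m le by (simp add: pre_def)
qed

lemma S_suf:
  assumes "frame p q"
  shows "x < sum D (suf p q)"
proof (rule ccontr)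
  assume "\<not> x < sum D (suf p q)"
  then have le: "sum D (suf p q) \<le> x"
    by simp
  have "gap p q - suf p q \<noteq> {}"
  proof
    assume "gap p q - suf p q = {}"
    then have "suf p q = gap p q"
      by (auto simp: suf_def)
    then show False
      using S_gap[OF assms] le by (simp add: S_def gap_def)
  qed
  then have "Max (gap p q - suf p q) \<in> gap p q - suf p q"
    by (intro Max_in) auto
  moreover define m where "m = Max (gap p q - suf p q)"
  ultimately have m: "m \<in> gap p q" "m \<notin> suf p q"
    by auto
  have "i \<in> suf p q" if "i \<in> {m<..<p + 2 * int h}" for i
  proof (rule ccontr)
    assume "i \<notin> suf p q"
    then have "i \<le> m"
      unfolding m_def using that m by (intro Max_ge) (auto simp: gap_def)
    then show False
      using that by simp
  qed
  then have "S m (p + 2 * int h) \<le> sum D (suf p q)"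
    unfolding S_def by (intro sum_mono2) (auto simp: D_nonneg)
  then show False
    using m le by (simp add: suf_def)
qed

text \<open>By \<open>core_low\<close> a frame that is not thin has at least as many deep points in its gap as there are
  points from \<open>p\<close> to \<open>q\<close>.\<close>

definition thin :: "int \<Rightarrow> int \<Rightarrow> bool" where
  "thin p q \<longleftrightarrow> card (pre p q) + card (suf p q) < 2 * h"

text \<open>Inclusion-exclusion: at least \<open>2 * h\<close> points in total, in a gap of only
  \<open>2 * h - 1 - (q - p)\<close>.\<close>

lemma card_core_if_not_thin:
  assumes "frame p q" "\<not> thin p q"
  shows "q - p + 1 \<le> int (card (pre p q \<inter> suf p q))"
proof -
  have "card (pre p q \<union> suf p q) \<le> card (gap p q)"
    by (intro card_mono) (auto simp: pre_def suf_def)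
  moreover have "int (card (gap p q)) = 2 * int h - 1 - (q - p)"
    using assms by (intro card_gap) (auto simp: frame_def)
  ultimately show ?thesis
    using assms(2) card_Un_Int[of "pre p q" "suf p q"] by (simp add: thin_def)
qed

text \<open>A maximum of \<open>y\<close> on the block gives a frame of width zero; by
  \<open>core_low\<close> its reachable sets are disjoint, in a gap of \<open>2 * h - 1\<close>
  points.\<close>

lemma frame_thin_exists: obtains p where "frame p p" "thin p p"
proof -
  have "finite (y ` {a..b})" "y ` {a..b} \<noteq> {}"
    using ab by auto
  then have "Max (y ` {a..b}) \<in> y ` {a..b}"
    by (rule Max_in)
  then obtain p where p: "p \<in> {a..b}" "y p = Max (y ` {a..b})"
    by auto
  then have max: "y i \<le> y p" if "i \<in> {a..b}" for i
    using that by simp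
  have high: "0 \<le> y p"
    using max[of a] high_ends ab by simp
  have "y i \<le> y p" if i: "i \<in> gap p p" for i
  proof -
    consider "i \<in> {a..b}" | "b < i" "i < a + 2 * int h" | "i - 2 * int h \<in> {a..b}"
      using i p(1) by (force simp: gap_def)
    then show ?thesis
      using max[of i] low_outside[of i] high max[of "i - 2 * int h"]
      by cases (auto simp: y_period)
  qed
  then have frame: "frame p p"
    using p(1) high by (auto simp: frame_def)
  have "pre p p \<inter> suf p p = {}"
    using core_low(2)[OF frame] by blast
  then have "card (pre p p) + card (suf p p) = card (pre p p \<union> suf p p)"
    by (simp add: card_Un_disjoint)
  also have "\<dots> \<le> card (gap p p)"
    by (intro card_mono) (auto simp: pre_def suf_def)
  also have "int (card (gap p p)) = 2 * int h - 1"
    using p(1) card_gap[of p p] by simp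
  then have "card (gap p p) < 2 * h"
    by linarith
  finally show ?thesis
    using frame that by (simp add: thin_def)
qed

text \<open>In a widest thin frame every level \<open>s \<le> \<tau>\<close> spans a wider frame, hence one that is not thin.
  So at every level the deficits \<open>u\<close> outnumber the excesses \<open>v\<close>, whereas thinness makes
  the weights in the gap too heavy for that.\<close>

lemma no_cut: False
proof -
  define width :: "int \<times> int \<Rightarrow> nat" where "width e = nat (snd e - fst e)" for e
  define tf where "tf e \<longleftrightarrow> frame (fst e) (snd e) \<and> thin (fst e) (snd e)" for e
  obtain p0 where "tf (p0, p0)"
    using frame_thin_exists by (auto simp: tf_def)
  moreover have "\<forall>e. tf e \<longrightarrow> width e < Suc (nat (b - a))"
    by (auto simp: tf_def width_def frame_def)
  ultimately obtain e where "tf e" and widest: "\<And>e'. tf e' \<Longrightarrow> width e' \<le> width e"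
    using ex_has_greatest_nat[of tf "(p0, p0)" width "Suc (nat (b - a))"] by auto
  define p q where "p = fst e" and "q = snd e"
  have frame: "frame p q" and thin: "thin p q"
    using \<open>tf e\<close> by (auto simp: tf_def p_def q_def)
  have max: "\<not> thin p' q'" if "frame p' q'" "q - p < q' - p'" for p' q'
    using widest[of "(p', q')"] that frame by (auto simp: tf_def width_def p_def q_def frame_def)
  define Q where "Q = gap p q"
  define v where "v i = max 0 (y i)" for i
  define u where "u i = max 0 (- y i) / (\<omega> - 1)" for i
  define \<tau> where "\<tau> = Max (y ` Q)"
  have pq: "a \<le> p" "p \<le> q" "q \<le> b" "0 \<le> y p" "0 \<le> y q"
    and dom: "\<And>i. i \<in> Q \<Longrightarrow> y i \<le> min (y p) (y q)"
    using frame by (auto simp: frame_def Q_def)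
  have finQ: "finite Q"
    by (simp add: Q_def)
  have subQ: "pre p q \<subseteq> Q" "suf p q \<subseteq> Q"
    by (auto simp: pre_def suf_def Q_def)
  have cardQ: "int (card Q) = 2 * int h - 1 - (q - p)"
    using card_gap pq by (simp add: Q_def)
  then have "Q \<noteq> {}"
    using pq block_short by auto
  then have "Max (y ` Q) \<in> y ` Q"
    using finQ by (intro Max_in) auto
  then obtain m where m: "m \<in> Q" "y m = \<tau>"
    by (auto simp: \<tau>_def)
  have le_tau: "y i \<le> \<tau>" if "i \<in> Q" for i
    using that finQ by (simp add: \<tau>_def)
  have y_uv: "y i = v i - (\<omega> - 1) * u i" for i
    using omega by (auto simp: u_def v_def)
  have sum_y: "sum y A = sum D A - real (card A) * \<delta>" for A
    by (simp add: y_def sum_subtractf)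

  \<comment> \<open>Fewer than \<open>h\<close> points carry weight above \<open>x\<close>, so their
    excess over \<delta> totals more than \<open>(h - 1) * \<epsilon>\<close>, and one of them
    exceeds \<epsilon>.\<close>
  have "card (pre p q) < h \<or> card (suf p q) < h"
    using thin by (auto simp: thin_def)
  then obtain Z where Z: "Z \<subseteq> Q" "card Z < h" "x < sum D Z"
    using subQ S_pre[OF frame] S_suf[OF frame] that by blast
  have cardZ: "real (card Z) \<le> real h - 1"
    using Z(2) by linarith
  then have "real (card Z) * \<delta> \<le> (real h - 1) * \<delta>"
    using delta_pos by (intro mult_right_mono) auto
  then have "(real h - 1) * \<epsilon> < sum y Z"
    using Z(3) by (simp add: sum_y x_def algebra_simps)
  also have "\<dots> \<le> sum v Z"
    by (intro sum_mono) (simp add: v_def)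
  finally have sum_vZ: "(real h - 1) * \<epsilon> < sum v Z" .
  have "sum v Z \<le> sum v Q"
    using Z(1) finQ by (intro sum_mono2) (auto simp: v_def)
  with sum_vZ have sum_v: "(real h - 1) * \<epsilon> < sum v Q"
    by simp
  have tau: "\<epsilon> < \<tau>"
  proof (rule ccontr)
    assume "\<not> \<epsilon> < \<tau>"
    then have "v i \<le> \<epsilon>" if "i \<in> Z" for i
      using le_tau[of i] Z(1) that eps_pos by (auto simp: v_def)
    then have "sum v Z \<le> real (card Z) * \<epsilon>"
      by (rule sum_bounded_above)
    also have "\<dots> \<le> (real h - 1) * \<epsilon>"
      using cardZ eps_pos by (intro mult_right_mono) auto
    finally show False
      using sum_vZ by simp
  qed

  \<comment> \<open>If the two sets overlap, they cover the gap and count the core twice. Thinness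
    bounds the count with multiplicity, and the second copy of the core is low, so it accounts for
    at most \<delta> per point.\<close>
  have sum_yQ: "2 * x - (2 * real h - 1) * \<delta> < sum y Q"
  proof (cases "pre p q \<inter> suf p q = {}")
    case True
    then have "sum D (pre p q) + sum D (suf p q) = sum D (pre p q \<union> suf p q)"
      by (simp add: sum.union_disjoint)
    also have "\<dots> \<le> sum D Q"
      using subQ finQ by (intro sum_mono2) (auto simp: D_nonneg)
    finally have "2 * x < sum D Q"
      using S_pre[OF frame] S_suf[OF frame] by linarith
    moreover have "real (card Q) \<le> 2 * real h - 1"
      using cardQ pq by linarith
    then have "real (card Q) * \<delta> \<le> (2 * real h - 1) * \<delta>"
      using delta_pos by (intro mult_right_mono) auto
    ultimately show ?thesis
      by (simp add: sum_y)
  next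
    case False
    then obtain i where i: "i \<in> pre p q" "i \<in> suf p q"
      by auto
    have "j \<in> pre p q \<union> suf p q" if "j \<in> Q" for j
      using that i S_mono[of q q j i] S_mono[of i j "p + 2 * int h" "p + 2 * int h"]
      by (cases "j \<le> i") (auto simp: pre_def suf_def Q_def)
    then have Q: "Q = pre p q \<union> suf p q"
      using subQ by auto
    have "y j < 0" if "j \<in> pre p q \<inter> suf p q" for j
    proof -
      have "y j < - ((\<omega> - 1) * min (y p) (y q))"
        using core_low[OF frame] that by blast
      moreover have "0 \<le> (\<omega> - 1) * min (y p) (y q)"
        using omega pq by (intro mult_nonneg_nonneg) auto
      ultimately show ?thesis
        by simp
    qed
    then have "sum D (pre p q \<inter> suf p q) \<le> real (card (pre p q \<inter> suf p q)) * \<delta>"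
      by (intro sum_bounded_above) (force simp: y_def)
    moreover have "sum D (pre p q) + sum D (suf p q) = sum D Q + sum D (pre p q \<inter> suf p q)"
      unfolding Q by (intro sum.union_inter[symmetric]) auto
    moreover have "card (pre p q) + card (suf p q) = card Q + card (pre p q \<inter> suf p q)"
      unfolding Q by (intro card_Un_Int) auto
    then have "real (card Q) + real (card (pre p q \<inter> suf p q)) \<le> 2 * real h - 1"
      using thin by (simp add: thin_def)
    then have "(real (card Q) + real (card (pre p q \<inter> suf p q))) * \<delta> \<le> (2 * real h - 1) * \<delta>"
      using delta_pos by (intro mult_right_mono) auto
    ultimately show ?thesis
      using S_pre[OF frame] S_suf[OF frame] by (simp add: sum_y algebra_simps)
  qed

  \<comment> \<open>The extra value \<tau> at \<open>q\<close> exploits the \<open>+ 1\<close> in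
    \<open>card_core_if_not_thin\<close>; without its contribution the final estimate would not
    close.\<close>
  define w where "w i = (if i = q then \<tau> else v i)" for i
  have "sum w (insert q Q) \<le> sum u Q"
  proof (rule sum_le_sum_if_level_card_le)
    fix s :: real assume s: "0 < s"
    show "card {i \<in> insert q Q. s \<le> w i} \<le> card {j \<in> Q. s \<le> u j}"
    proof (cases "s \<le> \<tau>")
      case False
      have "w i \<le> \<tau>" if "i \<in> insert q Q" for i
        using that le_tau[of i] tau eps_pos by (auto simp: w_def v_def)
      with False have "{i \<in> insert q Q. s \<le> w i} = {}"
        by fastforce
      then show ?thesis
        by (simp only: card.empty)
    next
      case True
      \<comment> \<open>The outermost block points at level \<open>s\<close> span a strictly wider
        frame, because \<open>m\<close> lies in the gap and reaches \<tau>; by the choice of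
        \<open>p\<close> and \<open>q\<close> that frame is not thin.\<close>
      define H where "H = {i \<in> {a..b}. s \<le> y i}"
      define p' q' where "p' = Min H" and "q' = Max H"
      have "finite H"
        by (rule finite_subset[of _ "{a..b}"]) (auto simp: H_def)
      moreover have "p \<in> H" "q \<in> H"
        using True dom[OF m(1)] m(2) pq by (auto simp: H_def)
      ultimately have H: "finite H" "p \<in> H" "q \<in> H"
        by simp_all
      have in_H: "p' \<in> H" "q' \<in> H"
        unfolding p'_def q'_def using H by (metis Min_in Max_in empty_iff)+
      have bounds: "p' \<le> i" "i \<le> q'" if "i \<in> H" for i
        using H that by (auto simp: p'_def q'_def)
      have trichotomy: "i \<in> H \<or> i - 2 * int h \<in> H" if "i \<in> Q" "s \<le> y i" for i
        using low_outside[of i] that s pq by (force simp: H_def Q_def gap_def y_period)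
      have wider: "q - p < q' - p'"
        using trichotomy[OF m(1)] m True bounds[of m] bounds[of "m - 2 * int h"]
          bounds[OF H(2)] bounds[OF H(3)] by (auto simp: Q_def gap_def)
      have gap_sub: "gap p' q' \<subseteq> Q"
        using bounds[OF H(2)] bounds[OF H(3)] by (auto simp: Q_def gap_def)
      have "y i < s" if "i \<in> gap p' q'" for i
        using trichotomy[of i] that gap_sub bounds[of i] bounds[of "i - 2 * int h"]
        by (force simp: gap_def)
      then have frame': "frame p' q'"
        using in_H bounds[OF H(2)] bounds[OF H(3)] pq s by (force simp: frame_def H_def)
      define K where "K = pre p' q' \<inter> suf p' q'"
      have K_sub: "K \<subseteq> {j \<in> Q. s \<le> u j}"
      proof
        fix j assume j: "j \<in> K"
        have "(\<omega> - 1) * s \<le> (\<omega> - 1) * min (y p') (y q')"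
          using in_H omega by (intro mult_left_mono) (auto simp: H_def)
        then have "(\<omega> - 1) * s \<le> - y j"
          using core_low(1)[OF frame', of j] j by (simp add: K_def)
        then have "s \<le> u j"
          using omega by (auto simp: u_def field_simps)
        moreover have "j \<in> Q"
          using j gap_sub by (auto simp: K_def pre_def)
        ultimately show "j \<in> {j \<in> Q. s \<le> u j}"
          by simp
      qed
      have "{i \<in> insert q Q. s \<le> w i} \<subseteq> {q..q'} \<union> {p' + 2 * int h..<p + 2 * int h}"
      proof
        fix i assume i: "i \<in> {i \<in> insert q Q. s \<le> w i}"
        show "i \<in> {q..q'} \<union> {p' + 2 * int h..<p + 2 * int h}"
        proof (cases "i = q")
          case True
          then show ?thesis
            using bounds[OF H(3)] by simp
        next
          case False
          then have "i \<in> Q" "s \<le> y i"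
            using i s by (auto simp: w_def v_def)
          then show ?thesis
            using trichotomy[of i] bounds[of i] bounds[of "i - 2 * int h"]
            by (auto simp: Q_def gap_def)
        qed
      qed
      then have "card {i \<in> insert q Q. s \<le> w i}
          \<le> card ({q..q'} \<union> {p' + 2 * int h..<p + 2 * int h})"
        by (intro card_mono) auto
      also have "\<dots> \<le> card {q..q'} + card {p' + 2 * int h..<p + 2 * int h}"
        by (rule card_Un_le)
      also have "\<dots> \<le> nat (q' - p' + 1)"
        using bounds[OF H(2)] bounds[OF H(3)] pq by simp
      also have "\<dots> \<le> card K"
        using card_core_if_not_thin[OF frame' max[OF frame' wider]] by (simp add: K_def)
      also have "\<dots> \<le> card {j \<in> Q. s \<le> u j}"
        using K_sub finQ by (intro card_mono) auto
      finally show ?thesis .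
    qed
  qed (use finQ tau eps_pos omega in \<open>auto simp: w_def v_def u_def\<close>)
  moreover have "sum w (insert q Q) = \<tau> + sum v Q"
  proof -
    have "q \<notin> Q"
      by (simp add: Q_def gap_def)
    then have "sum w Q = sum v Q"
      by (intro sum.cong) (auto simp: w_def)
    with \<open>q \<notin> Q\<close> finQ show ?thesis
      by (simp add: w_def)
  qed
  \<comment> \<open>Hence \<open>sum y Q\<close> is at most \<open>- (\<omega> - 2) * (h - 1) *
    \<epsilon> - (\<omega> - 1) * \<epsilon>\<close>. By the choice of \<delta> this equals the
    strict lower bound in \<open>sum_yQ\<close>.\<close>
  ultimately have "(\<omega> - 1) * (\<tau> + sum v Q) \<le> (\<omega> - 1) * sum u Q"
    using omega by (intro mult_left_mono) auto
  moreover have "sum y Q = sum v Q - (\<omega> - 1) * sum u Q"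
    by (simp add: y_uv sum_subtractf sum_distrib_left)
  moreover have "(\<omega> - 1) * \<epsilon> \<le> (\<omega> - 1) * \<tau>"
    using omega tau by (intro mult_left_mono) auto
  moreover have "(\<omega> - 2) * ((real h - 1) * \<epsilon>) \<le> (\<omega> - 2) * sum v Q"
    using omega sum_v by (intro mult_left_mono) auto
  moreover have "2 * x - (2 * real h - 1) * \<delta> = 2 * (real h - 1) * \<epsilon> - (real h * \<omega> - 1) * \<epsilon>"
    unfolding delta_eq[symmetric] by (simp add: x_def algebra_simps)
  ultimately show False
    using sum_yQ by (simp add: algebra_simps)
qed

end

lemma (in good_arcs) inconsistent: False
proof -
  obtain i j where *: "i < j" "j < i + 2 * int h" "0 \<le> y i" "0 \<le> y j" "\<not> G i j"
    "\<And>i' j'. i' < j' \<Longrightarrow> j' - i' < j - i \<Longrightarrow> 0 \<le> y i' \<Longrightarrow> 0 \<le> y j' \<Longrightarrow> G i' j'"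
    by (rule shortest_bad) blast
  interpret good_arcs_cut h \<omega> \<delta> \<epsilon> D G "j - 2 * int h" i
    by unfold_locales (use * in \<open>auto simp: y_period\<close>)
  show False
    by (rule no_cut)
qed

section \<open>The upper bound\<close>

lemma finite_C_set: "finite {max (P \<omega> k d i j) (P \<omega> k d j i) | i j. i < j \<and> j \<le> k - 1}"
  by (rule finite_subset[of _ "(\<lambda>(i, j). max (P \<omega> k d i j) (P \<omega> k d j i)) ` ({..k} \<times> {..k})"]) force+

lemma C_le_max:
  assumes "i < k" "j < k" "i \<noteq> j"
  shows "C \<omega> k d \<le> max (P \<omega> k d i j) (P \<omega> k d j i)"
proof -
  have "C \<omega> k d \<le> max (P \<omega> k d i j) (P \<omega> k d j i)" if "i < j" "j < k" for i j
    unfolding C_def using that by (intro Min_le finite_C_set) force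
  then show ?thesis
    using assms by (metis max.commute linorder_neqE_nat)
qed

lemma C_attained:
  assumes "2 \<le> k"
  obtains i j where "i < j" "j < k" "C \<omega> k d = max (P \<omega> k d i j) (P \<omega> k d j i)"
proof -
  have "max (P \<omega> k d 0 1) (P \<omega> k d 1 0)
      \<in> {max (P \<omega> k d i j) (P \<omega> k d j i) | i j. i < j \<and> j \<le> k - 1}"
    using assms by force
  then have "C \<omega> k d \<in> {max (P \<omega> k d i j) (P \<omega> k d j i) | i j. i < j \<and> j \<le> k - 1}"
    unfolding C_def by (intro Min_in finite_C_set) blast
  then obtain i j where "i < j" "j \<le> k - 1" "C \<omega> k d = max (P \<omega> k d i j) (P \<omega> k d j i)"
    by auto
  then show ?thesis
    using that by simp
qed

text \<open>If an outer argument is the minimum, the gains \<open>t\<close> at both ends exactly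
  cancel the loss \<open>(\<omega> - 1) * t\<close> in the middle. If the middle one is,
  \<open>(\<omega> - 2) * (\<omega> - 1) \<le> 2\<close> suffices, which follows from
  \<open>\<omega> \<le> 3\<close>.\<close>

lemma mmexp_le:
  assumes "2 \<le> \<omega>" "\<omega> \<le> 3" "0 \<le> t"
    and "a \<le> e - t" "b \<le> e + (\<omega> - 1) * t" "a' \<le> e - t"
  shows "mmexp \<omega> a b a' \<le> \<omega> * e"
proof -
  have m: "mmexp \<omega> a b a' \<in> {b + a' + (\<omega> - 2) * a, a + a' + (\<omega> - 2) * b, a + b + (\<omega> - 2) * a'}"
    by (auto simp: mmexp_def min_def algebra_simps)
  have "(\<omega> - 2) * a \<le> (\<omega> - 2) * (e - t)" "(\<omega> - 2) * a' \<le> (\<omega> - 2) * (e - t)"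
    using assms by (auto intro!: mult_left_mono)
  then have outer: "b + a' + (\<omega> - 2) * a \<le> \<omega> * e" "a + b + (\<omega> - 2) * a' \<le> \<omega> * e"
    using assms by (auto simp: algebra_simps)
  have "(\<omega> - 2) * (\<omega> - 1) \<le> 1 * 2"
    using assms by (intro mult_mono) auto
  then have "(\<omega> - 2) * (\<omega> - 1) * t \<le> 2 * t"
    using assms by (intro mult_right_mono) auto
  moreover have "(\<omega> - 2) * b \<le> (\<omega> - 2) * (e + (\<omega> - 1) * t)"
    using assms by (intro mult_left_mono) auto
  ultimately have "(\<omega> - 2) * b \<le> (\<omega> - 2) * e + 2 * t"
    by (simp only: distrib_left mult.assoc)
  then have "a + a' + (\<omega> - 2) * b \<le> \<omega> * e"
    using assms by (simp add: algebra_simps)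
  with m outer show ?thesis
    by auto
qed

definition bound :: "real \<Rightarrow> real \<Rightarrow> real" where
  "bound \<omega> h = (h\<^sup>2 * \<omega> - 1) / (h * \<omega> + h\<^sup>2 - h - 1)"

lemma bound_eq:
  assumes "0 < h"
  shows "(2 * h * \<omega> - 4 / (2 * h)) / (2 * \<omega> + 2 * h - 2 - 4 / (2 * h)) = bound \<omega> h"
proof -
  have "2 * h * \<omega> - 4 / (2 * h) = (2 / h) * (h\<^sup>2 * \<omega> - 1)"
    "2 * \<omega> + 2 * h - 2 - 4 / (2 * h) = (2 / h) * (h * \<omega> + h\<^sup>2 - h - 1)"
    using assms by (simp_all add: field_simps power2_eq_square)
  then show ?thesis
    using assms by (simp only: bound_def) (subst mult_divide_mult_cancel_left, auto)
qed

text \<open>The contradiction is with \<open>good_arcs\<close>, an arc being good if its \<open>P\<close>-value is at most the bound.\<close>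

lemma C_le_bound:
  assumes "2 \<le> \<omega>" "\<omega> \<le> 3" "2 \<le> h" and d: "\<And>i. i < 2 * h \<Longrightarrow> 0 \<le> d i"
  shows "C \<omega> (2 * h) d \<le> bound \<omega> (real h)"
proof (rule ccontr)
  assume gt: "\<not> ?thesis"
  define den where "den = real h * \<omega> + (real h)\<^sup>2 - real h - 1"
  \<comment> \<open>The solution of \<open>1 + (h - 1) * (\<delta> + \<epsilon>) = \<omega> * (1 -
    \<delta>)\<close> with \<open>\<delta> = (h * \<omega> - 1) * \<epsilon>\<close>.\<close>
  define \<epsilon> where "\<epsilon> = (\<omega> - 1) / (\<omega> * den)"
  define \<delta> where "\<delta> = (real h * \<omega> - 1) * \<epsilon>"
  have "2 \<le> real h" "2 * real h \<le> real h * \<omega>" "2 * real h \<le> (real h)\<^sup>2"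
    using assms by (auto simp: power2_eq_square)
  then have den: "0 < den"
    unfolding den_def by linarith
  have e: "\<epsilon> * (\<omega> * den) = \<omega> - 1" "0 < \<epsilon>"
    using den assms by (auto simp: \<epsilon>_def)
  have bound1: "bound \<omega> (real h) = 1 + (real h - 1) * (\<delta> + \<epsilon>)"
  proof -
    have "(real h - 1) * (\<delta> + \<epsilon>) * den = (real h - 1) * real h * (\<epsilon> * (\<omega> * den))"
      by (simp add: \<delta>_def algebra_simps)
    then have "(1 + (real h - 1) * (\<delta> + \<epsilon>)) * den = den + (real h - 1) * real h * (\<omega> - 1)"
      by (simp only: distrib_right e(1) mult_1)
    also have "\<dots> = (real h)\<^sup>2 * \<omega> - 1"
      by (simp add: den_def power2_eq_square algebra_simps)
    finally show ?thesis
      using den by (simp add: bound_def den_def[symmetric] divide_eq_eq)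
  qed
  have bound2: "bound \<omega> (real h) = \<omega> * (1 - \<delta>)"
  proof -
    have "\<omega> * \<delta> * den = (real h * \<omega> - 1) * (\<epsilon> * (\<omega> * den))"
      by (simp add: \<delta>_def)
    then have "\<omega> * (1 - \<delta>) * den = \<omega> * den - (real h * \<omega> - 1) * (\<omega> - 1)"
      by (simp only: right_diff_distrib left_diff_distrib e(1) mult_1_right)
    also have "\<dots> = (real h)\<^sup>2 * \<omega> - 1"
      by (simp add: den_def power2_eq_square algebra_simps)
    finally show ?thesis
      using den by (simp add: bound_def den_def[symmetric] divide_eq_eq)
  qed
  have k: "0 < 2 * h"
    using assms by simp
  interpret good_arcs h \<omega> \<delta> \<epsilon> "\<lambda>i. d (idx (2 * h) i)"
    "\<lambda>i j. arcP \<omega> (2 * h) d i j \<le> bound \<omega> (real h)"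
  proof
    fix i j :: int
    assume ij: "i < j" "j < i + 2 * int h"
    show "arcP \<omega> (2 * h) d i j \<le> bound \<omega> (real h)"
      if "(\<Sum>r\<in>{i<..<j}. d (idx (2 * h) r)) \<le> (real h - 1) * (\<delta> + \<epsilon>)"
      using arcP_le_sum[of i j "2 * h" \<omega> d] ij that bound1 by simp
    show "\<not> arcP \<omega> (2 * h) d j (i + 2 * int h) \<le> bound \<omega> (real h)"
      if "arcP \<omega> (2 * h) d i j \<le> bound \<omega> (real h)"
    proof
      assume "arcP \<omega> (2 * h) d j (i + 2 * int h) \<le> bound \<omega> (real h)"
      moreover have "idx (2 * h) (i + 2 * int h) = idx (2 * h) i"
        using idx_add_period[of "2 * h" i] by simp
      moreover have "idx (2 * h) i \<noteq> idx (2 * h) j"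
        using ij k by (subst idx_eq_iff) auto
      then have "C \<omega> (2 * h) d
          \<le> max (P \<omega> (2 * h) d (idx (2 * h) i) (idx (2 * h) j)) (P \<omega> (2 * h) d (idx (2 * h) j) (idx (2 * h) i))"
        by (intro C_le_max idx_less k)
      ultimately show False
        using that gt by (simp add: arcP_def)
    qed
  next
    fix i r j :: int and t :: real
    assume *: "i < r" "r < j" "j < i + 2 * int h" "arcP \<omega> (2 * h) d i r \<le> bound \<omega> (real h)"
      "arcP \<omega> (2 * h) d r j \<le> bound \<omega> (real h)" "0 \<le> t" "t \<le> d (idx (2 * h) i) - \<delta>"
      "t \<le> d (idx (2 * h) j) - \<delta>" "- ((\<omega> - 1) * t) \<le> d (idx (2 * h) r) - \<delta>"
    have "mmexp \<omega> (1 - d (idx (2 * h) i)) (1 - d (idx (2 * h) r)) (1 - d (idx (2 * h) j)) \<le> \<omega> * (1 - \<delta>)"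
      using assms * by (intro mmexp_le[of \<omega> t]) auto
    then show "arcP \<omega> (2 * h) d i j \<le> bound \<omega> (real h)"
      using arcP_combine[of i r j "2 * h" \<omega> d] * bound2 by (auto simp: max_def split: if_splits)
  next
    fix i :: int
    show "0 \<le> d (idx (2 * h) i)"
      using d idx_less[OF k] by simp
    show "d (idx (2 * h) (i + 2 * int h)) = d (idx (2 * h) i)"
      using idx_add_period[of "2 * h" i] by simp
  qed (use assms e \<delta>_def in auto)
  show False
    by (rule inconsistent)
qed

section \<open>Extremal weights for exponent two\<close>

text \<open>Up to the factor \<open>1 / (h\<^sup>2 + h - 1)\<close>, the weights around the circle are \<open>h - 1\<close> (\<open>h\<close> times),
  \<open>h\<close> (\<open>h - 1\<close> times) and \<open>2 * h - 2\<close> (once). In these units \<open>bound 2 h - 1\<close> is \<open>h * (h - 1)\<close>.\<close>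

definition wt :: "nat \<Rightarrow> int \<Rightarrow> real" where
  "wt h i = (let m = i mod (2 * int h) in
     if m < int h then real h - 1 else if m < 2 * int h - 1 then real h else 2 * real h - 2)"

lemma wt_shift: "wt h (i - 2 * int h * s) = wt h i"
proof -
  have "(i - 2 * int h * s) mod (2 * int h) = i mod (2 * int h)"
    by (subst mod_eq_dvd_iff) simp
  then show ?thesis
    by (simp add: wt_def)
qed

lemma wt_ge: "2 \<le> h \<Longrightarrow> real h - 1 \<le> wt h i"
  by (simp add: wt_def Let_def)

lemma wt_cases:
  assumes "2 \<le> h" "0 \<le> i" "i < 4 * int h"
  shows "wt h i = (if i < int h \<or> 2 * int h \<le> i \<and> i < 3 * int h then real h - 1
    else if i = 2 * int h - 1 \<or> i = 4 * int h - 1 then 2 * real h - 2 else real h)"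
proof (cases "i < 2 * int h")
  case True
  then show ?thesis
    using assms by (simp add: wt_def Let_def)
next
  case False
  then have "(i - 2 * int h) mod (2 * int h) = i - 2 * int h"
    using assms by (intro mod_pos_pos_trivial) auto
  then have "i mod (2 * int h) = i - 2 * int h"
    by (metis minus_mod_self2)
  then show ?thesis
    using False assms by (simp add: wt_def Let_def)
qed

section \<open>Heavy arcs for the extremal weights\<close>

lemma card_le_sum_wt:
  assumes "2 \<le> h" "finite A"
  shows "real (card A) * (real h - 1) \<le> sum (wt h) A"
  using sum_bounded_below[of A "real h - 1" "wt h"] wt_ge[OF assms(1)] by simp

lemma sum_wt_ge_if_length:
  assumes "2 \<le> h" "int h < j - i"
  shows "real h * (real h - 1) \<le> sum (wt h) {i<..<j}"
proof -
  have "real h * (real h - 1) \<le> real (card {i<..<j}) * (real h - 1)"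
    using assms by (intro mult_right_mono) auto
  then show ?thesis
    using card_le_sum_wt[OF assms(1), of "{i<..<j}"] by simp
qed

text \<open>Unless both arcs have \<open>h - 1\<close> interior points, one has at least
  \<open>h\<close>, each of weight at least \<open>h - 1\<close>. In the balanced case one arc
  contains all points of weight \<open>h\<close>, or the point of weight \<open>2 * h - 2\<close>
  and \<open>h - 2\<close> others.\<close>

lemma sum_wt_either_ge:
  assumes h: "2 \<le> h" and ij: "0 \<le> i" "i < j" "j < 2 * int h"
  shows "real h * (real h - 1) \<le> sum (wt h) {i<..<j} \<or>
    real h * (real h - 1) \<le> sum (wt h) {j<..<i + 2 * int h}"
proof -
  consider "int h < j - i" | "int h < i + 2 * int h - j"
    | "j = 2 * int h - 1" "i = int h - 1" | "j < 2 * int h - 1" "j - i = int h"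
    using ij by linarith
  then show ?thesis
  proof cases
    case 3
    have "sum (wt h) {i<..<j} = (\<Sum>r\<in>{i<..<j}. real h)"
      using 3 h by (intro sum.cong) (auto simp: wt_cases)
    then show ?thesis
      using 3 h by (simp add: mult.commute)
  next
    case 4
    define A where "A = {j<..<i + 2 * int h} - {2 * int h - 1}"
    have "{j<..<i + 2 * int h} = insert (2 * int h - 1) A"
      using 4 ij h by (auto simp: A_def)
    moreover have "finite A" "2 * int h - 1 \<notin> A" "wt h (2 * int h - 1) = 2 * real h - 2"
      using h by (auto simp: A_def wt_cases)
    ultimately have sum: "sum (wt h) {j<..<i + 2 * int h} = 2 * real h - 2 + sum (wt h) A"
      by simp
    have "card A = h - 2"
      using 4 ij h by (simp add: A_def)
    then have "(real h - 2) * (real h - 1) \<le> sum (wt h) A"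
      using card_le_sum_wt[OF h, of A] h by (simp add: A_def)
    then show ?thesis
      using sum by (simp add: algebra_simps)
  qed (use sum_wt_ge_if_length[OF h] in auto)
qed

lemma sum_wt_shift: "sum (wt h) {i + 2 * int h * s<..<j + 2 * int h * s} = sum (wt h) {i<..<j}"
  by (rule sum.reindex_bij_witness[of _ "\<lambda>r. r + 2 * int h * s" "\<lambda>r. r - 2 * int h * s"])
    (auto simp: wt_shift)

text \<open>A combination step below the target exponent needs three points in the block of the large
  weights, and then the sum over the arc leaves a margin of one unit or one part is already heavy.\<close>

lemma sum_wt_le_combine:
  assumes h: "2 \<le> h" and irj: "i < r" "r < j" "j < i + 2 * int h"
    and large: "2 * real h - 1 < wt h i + wt h r + wt h j - max (wt h i) (max (wt h r) (wt h j))"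
  shows "wt h i + wt h r + wt h j - max (wt h i) (max (wt h r) (wt h j)) \<le> 2 * real h"
    and "real h * (real h - 1) \<le> sum (wt h) {i<..<r} \<or> real h * (real h - 1) \<le> sum (wt h) {r<..<j}
      \<or> sum (wt h) {i<..<j} \<le> real h * (real h - 1) - 1"
proof -
  define s where "s = i div (2 * int h)"
  define i' r' j' where "i' = i - 2 * int h * s" and "r' = r - 2 * int h * s" and "j' = j - 2 * int h * s"
  have i': "0 \<le> i'" "i' < 2 * int h"
    using h by (auto simp: i'_def s_def minus_mult_div_eq_mod)
  have irj': "i' < r'" "r' < j'" "j' < i' + 2 * int h"
    using irj by (auto simp: i'_def r'_def j'_def)
  have wt_eq: "wt h i = wt h i'" "wt h r = wt h r'" "wt h j = wt h j'"
    by (simp_all add: i'_def r'_def j'_def wt_shift)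
  have sum_eq: "sum (wt h) {i<..<r} = sum (wt h) {i'<..<r'}"
    "sum (wt h) {r<..<j} = sum (wt h) {r'<..<j'}" "sum (wt h) {i<..<j} = sum (wt h) {i'<..<j'}"
    using sum_wt_shift[of h i' s r'] sum_wt_shift[of h r' s j'] sum_wt_shift[of h i' s j']
    by (simp_all add: i'_def r'_def j'_def)
  have w: "wt h l = (if l < int h \<or> 2 * int h \<le> l \<and> l < 3 * int h then real h - 1
    else if l = 2 * int h - 1 \<or> l = 4 * int h - 1 then 2 * real h - 2 else real h)"
    if "l \<in> {i', r', j'}" for l
    using that h i' irj' by (intro wt_cases) auto
  \<comment> \<open>\<open>large\<close> concerns the two smallest weights. At most one of the three
    points is the special one of weight \<open>2 * h - 2\<close>, so a point of weight
    \<open>h - 1\<close> would keep their sum at \<open>2 * h - 1\<close> or less.\<close>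
  have block: "int h \<le> l \<and> (l < 2 * int h \<or> 3 * int h \<le> l)" if "l \<in> {i', r', j'}" for l
    using that large[unfolded wt_eq] w[of i'] w[of r'] w[of j'] h i' irj'
    by (auto simp: max_def split: if_splits)
  show "wt h i + wt h r + wt h j - max (wt h i) (max (wt h r) (wt h j)) \<le> 2 * real h"
    unfolding wt_eq using w[of i'] w[of r'] w[of j'] h i' irj'
    by (auto simp: max_def split: if_splits)
  show "real h * (real h - 1) \<le> sum (wt h) {i<..<r} \<or> real h * (real h - 1) \<le> sum (wt h) {r<..<j}
      \<or> sum (wt h) {i<..<j} \<le> real h * (real h - 1) - 1"
  \<comment> \<open>In a single block of large weights the interior has at most \<open>h - 2\<close>
    points, none of them special. Otherwise a whole block of small weights separates two consecutive
    points.\<close>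
  proof (cases "j' < 2 * int h")
    case True
    have "sum (wt h) {i'<..<j'} \<le> real (card {i'<..<j'}) * real h"
      using True block[of i'] h by (intro sum_bounded_above) (auto simp: wt_cases)
    also have "\<dots> \<le> (real h - 2) * real h"
      using True block[of i'] irj' h by (intro mult_right_mono) auto
    also have "\<dots> \<le> real h * (real h - 1) - 1"
      using h by (simp add: algebra_simps)
    finally show ?thesis
      by (simp add: sum_eq)
  next
    case False
    then have "int h < r' - i' \<or> int h < j' - r'"
      using block[of r'] block[of j'] i' by auto
    then show ?thesis
      unfolding sum_eq using sum_wt_ge_if_length[OF h] by blast
  qed
qed

lemma bound_2: "bound 2 h = (2 * h\<^sup>2 - 1) / (h\<^sup>2 + h - 1)"
  by (simp add: bound_def algebra_simps)

lemma mmexp_2_scaled: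
  assumes "0 < e"
  shows "mmexp 2 (1 - e * a) (1 - e * b) (1 - e * a') = 2 - e * (a + b + a' - max a (max b a'))"
  using assms by (simp add: mmexp_def min_def max_def algebra_simps)

text \<open>Induction on arc length. Extending an arc adds exactly the weight gained. A combination
  whose two smallest weights sum to at most \<open>2 * h - 1\<close> costs at least the cap, since
  \<open>1 / e - (2 * h - 1) = h * (h - 1)\<close>; the others are settled by
  \<open>sum_wt_le_combine\<close>.\<close>

lemma arcP_ge_wt:
  fixes h :: nat
  assumes h: "2 \<le> h" and ij: "i < j" "j < i + 2 * int h"
    and e: "e = 1 / ((real h)\<^sup>2 + real h - 1)"
    and d: "\<And>i. d (idx (2 * h) i) = e * wt h i"
  shows "1 + e * min (real h * (real h - 1)) (sum (wt h) {i<..<j}) \<le> arcP 2 (2 * h) d i j"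
  using ij
proof (induction "nat (j - i)" arbitrary: i j rule: less_induct)
  case less
  define low where "low i j = 1 + e * min (real h * (real h - 1)) (sum (wt h) {i<..<j})" for i j
  have "2 \<le> real h" "2 * real h \<le> (real h)\<^sup>2"
    using h by (auto simp: power2_eq_square)
  then have "0 < (real h)\<^sup>2 + real h - 1"
    by linarith
  then have e_pos: "0 < e" and e_eq: "e * ((real h)\<^sup>2 + real h - 1) = 1"
    unfolding e by simp_all
  have IH: "low i' j' \<le> arcP 2 (2 * h) d i' j'" if "i \<le> i'" "i' < j'" "j' \<le> j" "j' - i' < j - i" for i' j'
    unfolding low_def using that less.prems by (intro less.hyps) auto
  have low_step: "low i' j' \<le> low i'' j'' + e * s"
    if "sum (wt h) {i'<..<j'} = sum (wt h) {i''<..<j''} + s" "0 \<le> s" for i' j' i'' j'' s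
  proof -
    have "min (real h * (real h - 1)) (sum (wt h) {i'<..<j'})
        \<le> min (real h * (real h - 1)) (sum (wt h) {i''<..<j''}) + s"
      using that by linarith
    from mult_left_mono[OF this, of e] show ?thesis
      using e_pos by (simp add: low_def algebra_simps)
  qed
  have wt_nonneg: "0 \<le> wt h l" for l
    using wt_ge[OF h, of l] h by simp
  show ?case
  proof (cases "j = i + 1")
    case True
    then have "{i<..<j} = {}"
      by auto
    then have "low i j = 1"
      using h by (simp add: low_def)
    moreover have "arcP 2 (2 * h) d i j = 1"
      using True less.prems by (simp add: arcP_rec)
    ultimately show ?thesis
      by (simp only: low_def order_refl)
  next
    case False
    have "{i<..<j} = insert (j - 1) {i<..<j - 1}"
      using False less.prems by auto
    then have "sum (wt h) {i<..<j} = sum (wt h) {i<..<j - 1} + wt h (j - 1)"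
      by simp
    from low_step[OF this wt_nonneg]
    have step1: "low i j \<le> arcP 2 (2 * h) d i (j - 1) + d (idx (2 * h) (j - 1))"
      using IH[of i "j - 1"] False less.prems by (simp add: d)
    have "{i<..<j} = insert (i + 1) {i + 1<..<j}"
      using False less.prems by auto
    then have "sum (wt h) {i<..<j} = sum (wt h) {i + 1<..<j} + wt h (i + 1)"
      by simp
    from low_step[OF this wt_nonneg]
    have step2: "low i j \<le> arcP 2 (2 * h) d (i + 1) j + d (idx (2 * h) (i + 1))"
      using IH[of "i + 1" j] False less.prems by (simp add: d)
    have "low i j \<le> max (arcP 2 (2 * h) d i r) (max (arcP 2 (2 * h) d r j)
        (mmexp 2 (1 - d (idx (2 * h) i)) (1 - d (idx (2 * h) r)) (1 - d (idx (2 * h) j))))"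
      if r: "r \<in> {i<..<j}" for r
    proof -
      define s2 where "s2 = wt h i + wt h r + wt h j - max (wt h i) (max (wt h r) (wt h j))"
      have mm: "mmexp 2 (1 - d (idx (2 * h) i)) (1 - d (idx (2 * h) r)) (1 - d (idx (2 * h) j)) = 2 - e * s2"
        using mmexp_2_scaled[OF e_pos] by (simp add: d s2_def)
      have via_mm: "low i j \<le> 2 - e * s2"
        if "min (real h * (real h - 1)) (sum (wt h) {i<..<j}) \<le> (real h)\<^sup>2 + real h - 1 - s2"
        using mult_left_mono[OF that, of e] e_pos e_eq by (simp add: low_def algebra_simps)
      have full: "low i j \<le> arcP 2 (2 * h) d i' j'"
        if "real h * (real h - 1) \<le> sum (wt h) {i'<..<j'}" "i \<le> i'" "i' < j'" "j' \<le> j" "j' - i' < j - i" for i' j'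
      proof -
        have "low i j \<le> low i' j'"
          unfolding low_def using that(1) e_pos by (intro add_left_mono mult_left_mono) auto
        then show ?thesis
          using IH[OF that(2-)] by linarith
      qed
      have sq: "(real h)\<^sup>2 = real h * real h"
        by (rule power2_eq_square)
      show ?thesis
      proof (cases "s2 \<le> 2 * real h - 1")
        case True
        then have "low i j \<le> 2 - e * s2"
          by (intro via_mm) (simp add: sq min_le_iff_disj algebra_simps)
        then show ?thesis
          by (simp add: mm)
      next
        case False
        then have "s2 \<le> 2 * real h"
          and "real h * (real h - 1) \<le> sum (wt h) {i<..<r} \<or> real h * (real h - 1) \<le> sum (wt h) {r<..<j}
            \<or> sum (wt h) {i<..<j} \<le> real h * (real h - 1) - 1"
          using sum_wt_le_combine[OF h, of i r j] r less.prems by (auto simp: s2_def)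
        then consider "real h * (real h - 1) \<le> sum (wt h) {i<..<r}"
          | "real h * (real h - 1) \<le> sum (wt h) {r<..<j}"
          | "min (real h * (real h - 1)) (sum (wt h) {i<..<j}) \<le> (real h)\<^sup>2 + real h - 1 - s2"
          by (fastforce simp: sq min_le_iff_disj algebra_simps)
        then show ?thesis
          using full[of i r] full[of r j] via_mm r by cases (auto simp: mm le_max_iff_disj)
      qed
    qed
    moreover have "i + 1 \<in> {i<..<j}"
      using False less.prems by simp
    then have "{i<..<j} \<noteq> {}"
      by blast
    ultimately have "low i j \<le> (MIN r\<in>{i<..<j}. max (arcP 2 (2 * h) d i r) (max (arcP 2 (2 * h) d r j)
        (mmexp 2 (1 - d (idx (2 * h) i)) (1 - d (idx (2 * h) r)) (1 - d (idx (2 * h) j)))))"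
      by (subst Min_ge_iff) auto
    then show ?thesis
      using step1 step2 False less.prems unfolding low_def[symmetric]
      by (simp only: arcP_rec[of i j "2 * h"] min.bounded_iff if_False)
  qed
qed

lemma bound_2_le_C:
  assumes h: "2 \<le> h" and e: "e = 1 / ((real h)\<^sup>2 + real h - 1)"
    and d: "\<And>i. i < 2 * h \<Longrightarrow> d i = e * wt h (int i)"
  shows "bound 2 (real h) \<le> C 2 (2 * h) d"
proof -
  have k: "0 < 2 * h"
    using h by simp
  have d': "d (idx (2 * h) i) = e * wt h i" for i
    using d[OF idx_less[OF k, of i]] int_idx[OF k, of i] by (simp add: wt_def)
  have "2 \<le> real h" "2 * real h \<le> (real h)\<^sup>2"
    using h by (auto simp: power2_eq_square)
  then have den: "0 < (real h)\<^sup>2 + real h - 1"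
    by linarith
  have eq: "bound 2 (real h) = 1 + e * (real h * (real h - 1))"
    using den by (simp add: bound_2 e field_simps power2_eq_square)
  obtain i j where ij: "i < j" "j < 2 * h" and C: "C 2 (2 * h) d = max (P 2 (2 * h) d i j) (P 2 (2 * h) d j i)"
    using C_attained[of "2 * h" 2 d] h by auto
  have "idx (2 * h) (int i + 2 * int h) = i"
    using idx_add_period[of "2 * h" "int i"] idx_of_nat[of i "2 * h"] ij by simp
  then have P: "P 2 (2 * h) d i j = arcP 2 (2 * h) d (int i) (int j)"
    "P 2 (2 * h) d j i = arcP 2 (2 * h) d (int j) (int i + 2 * int h)"
    using ij by (auto simp: arcP_def idx_of_nat)
  have "1 + e * min (real h * (real h - 1)) (sum (wt h) {int i<..<int j}) \<le> P 2 (2 * h) d i j"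
    "1 + e * min (real h * (real h - 1)) (sum (wt h) {int j<..<int i + 2 * int h}) \<le> P 2 (2 * h) d j i"
    unfolding P using ij by (auto intro!: arcP_ge_wt[OF h _ _ e d'])
  then show ?thesis
    using sum_wt_either_ge[OF h, of "int i" "int j"] ij unfolding C eq
    by (auto simp: min_def le_max_iff_disj split: if_splits)
qed

theorem theorem5p3:
  fixes \<omega> :: real and k :: nat
  assumes "2 \<le> \<omega>" "\<omega> \<le> 3" "even k" "4 \<le> k"
  shows "c \<omega> k \<le> (real k * \<omega> - 4 / real k) / (2 * \<omega> + real k - 2 - 4 / real k)
    \<and> (\<omega> = 2 \<longrightarrow>
          c \<omega> k = (real k * \<omega> - 4 / real k) / (2 * \<omega> + real k - 2 - 4 / real k))"
proof -
  obtain h where k: "k = 2 * h"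
    using assms(3) by blast
  then have h: "2 \<le> h"
    using assms(4) by simp
  have rhs: "(real k * \<omega> - 4 / real k) / (2 * \<omega> + real k - 2 - 4 / real k) = bound \<omega> (real h)"
    using bound_eq[of "real h" \<omega>] h by (simp add: k)
  have upper: "c \<omega> k \<le> bound \<omega> (real h)"
    unfolding c_def
  proof (rule cSUP_least)
    show "{..<k} \<rightarrow>\<^sub>E {0..1::real} \<noteq> {}"
      by (simp add: PiE_eq_empty_iff)
    fix d :: "nat \<Rightarrow> real"
    assume "d \<in> {..<k} \<rightarrow>\<^sub>E {0..1}"
    then have "C \<omega> k d \<le> bound \<omega> (real h)"
      unfolding k using assms h by (intro C_le_bound) (auto simp: PiE_iff)
    then show "min (MIN i\<in>{..<k}. 2 - d i) (C \<omega> k d) \<le> bound \<omega> (real h)"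
      by (simp add: min_le_iff_disj)
  qed
  have lower: "bound 2 (real h) \<le> c 2 k"
  proof -
    define den where "den = (real h)\<^sup>2 + real h - 1"
    define d where "d = (\<lambda>i\<in>{..<k}. 1 / den * wt h (int i))"
    have "2 \<le> real h" "2 * real h \<le> (real h)\<^sup>2"
      using h by (auto simp: power2_eq_square)
    then have den: "2 * real h - 1 \<le> den" "0 < den"
      unfolding den_def by linarith+
    have wt: "0 \<le> wt h i" "wt h i \<le> 2 * real h - 1" for i
      using h by (auto simp: wt_def Let_def)
    have d_bounds: "0 \<le> d i" "d i \<le> 1" "bound 2 (real h) \<le> 2 - d i" if "i < k" for i
    proof -
      \<comment> \<open>The weights are at most \<open>2 * h - 1\<close>, which is
        \<open>den * (2 - bound 2 h)\<close>, so no term \<open>2 - d i\<close> falls below the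
        bound.\<close>
      have "2 - bound 2 (real h) = (2 * den - (2 * (real h)\<^sup>2 - 1)) / den"
        using den unfolding bound_2 den_def[symmetric] by (simp add: diff_divide_distrib)
      also have "2 * den - (2 * (real h)\<^sup>2 - 1) = 2 * real h - 1"
        by (simp add: den_def)
      finally have "2 - bound 2 (real h) = (2 * real h - 1) / den" .
      then show "bound 2 (real h) \<le> 2 - d i"
        using that wt(2)[of "int i"] den divide_right_mono[of "wt h (int i)" "2 * real h - 1" den]
        by (simp add: d_def)
      show "0 \<le> d i" "d i \<le> 1"
        using that wt[of "int i"] den by (auto simp: d_def)
    qed
    have "bound 2 (real h) \<le> C 2 k d"
      unfolding k by (rule bound_2_le_C[OF h refl]) (simp add: d_def k den_def)
    moreover have "bound 2 (real h) \<le> (MIN i\<in>{..<k}. 2 - d i)"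
      using assms(4) d_bounds(3) by (subst Min_ge_iff) (auto simp: lessThan_empty_iff)
    moreover have "d \<in> {..<k} \<rightarrow>\<^sub>E {0..1}"
      using d_bounds by (auto simp: d_def)
    then have "min (MIN i\<in>{..<k}. 2 - d i) (C 2 k d) \<le> c 2 k"
      unfolding c_def using assms(4) by (intro cSUP_upper c_bdd_above) auto
    ultimately show ?thesis
      by simp
  qed
  show ?thesis
    unfolding rhs using upper lower by auto
qed

end
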